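(* Let $(a_i)$ be a computable increasing sequence of rational numbers converging to a real $\alpha$. Then $\alpha$ is not Martin-Löf random if and only if for every rational $\varepsilon>0$ one can effectively (uniformly in $\varepsilon$) find a computable sequence $h_0,h_1,\dots$ of non-negative rational numbers such that $\sum_i h_i<\varepsilon$ and $\alpha\le a_i+h_i$ for some $i$. *)

theory Defs
  imports "HOL-Analysis.Analysis" "HOL-Library.Nat_Bijection"
begin

datatype recf =
    Zero
  | Succ
  | Proj nat
  | Comp recf "recf list"
  | PrimRec recf recf
  | Mu recf

text \<open>
  \<open>evaluates f xs y\<close>: the partial recursive function described by \<open>f\<close> is defined on the
  argument list \<open>xs\<close> and has value \<open>y\<close> there. Arities are implicit; \<open>Zero\<close> stands for
  the zero function of every arity, and \<open>Proj\<close> counts from 0. The recursion argument of \<open>PrimRec\<close> and the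
  search argument of \<open>Mu\<close> come first; as usual, \<open>Mu f\<close> is only defined at \<open>xs\<close> if \<open>f\<close> is
  defined at all arguments smaller than the first zero.
\<close>

inductive evaluates :: "recf \<Rightarrow> nat list \<Rightarrow> nat \<Rightarrow> bool" where
  Zero: "evaluates Zero xs 0"
| Succ: "evaluates Succ [x] (Suc x)"
| Proj: "i < length xs \<Longrightarrow> evaluates (Proj i) xs (xs ! i)"
| Comp: "list_all2 (\<lambda>g y. evaluates g xs y) gs ys \<Longrightarrow> evaluates f ys z
    \<Longrightarrow> evaluates (Comp f gs) xs z"
| PrimRec_0: "evaluates f xs y \<Longrightarrow> evaluates (PrimRec f g) (0 # xs) y"
| PrimRec_Suc: "evaluates (PrimRec f g) (n # xs) y \<Longrightarrow> evaluates g (n # y # xs) z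
    \<Longrightarrow> evaluates (PrimRec f g) (Suc n # xs) z"
| Mu: "evaluates f (n # xs) 0 \<Longrightarrow> (\<And>m. m < n \<Longrightarrow> \<exists>y>0. evaluates f (m # xs) y)
    \<Longrightarrow> evaluates (Mu f) xs n"

inductive_cases evaluates_ZeroE: "evaluates Zero xs y"
inductive_cases evaluates_SuccE: "evaluates Succ xs y"
inductive_cases evaluates_ProjE: "evaluates (Proj i) xs y"
inductive_cases evaluates_CompE: "evaluates (Comp f gs) xs y"
inductive_cases evaluates_PrimRec_0E: "evaluates (PrimRec f g) (0 # xs) y"
inductive_cases evaluates_PrimRec_SucE: "evaluates (PrimRec f g) (Suc n # xs) y"
inductive_cases evaluates_MuE: "evaluates (Mu f) xs y"

lemma evaluates_deterministic:
  "evaluates f xs y \<Longrightarrow> evaluates f xs z \<Longrightarrow> y = z"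
proof (induction f xs y arbitrary: z rule: evaluates.induct)
  case (Zero xs)
  then show ?case by (auto elim: evaluates_ZeroE)
next
  case (Succ x)
  then show ?case by (auto elim: evaluates_SuccE)
next
  case (Proj i xs)
  then show ?case by (auto elim: evaluates_ProjE)
next
  case (Comp xs gs ys f y)
  from Comp.prems obtain ys' where
    ys': "list_all2 (\<lambda>g y. evaluates g xs y) gs ys'" and z: "evaluates f ys' z"
    by (auto elim: evaluates_CompE)
  have "ys = ys'"
  proof (rule nth_equalityI)
    show "length ys = length ys'"
      using list_all2_lengthD[OF Comp.IH(1)] list_all2_lengthD[OF ys'] by simp
  next
    fix i assume "i < length ys"
    then show "ys ! i = ys' ! i"
      using Comp.IH(1) ys' by (auto simp: list_all2_conv_all_nth)
  qed
  then show ?case using Comp.IH(2) z by simp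
next
  case (PrimRec_0 f xs y g)
  from PrimRec_0.prems have "evaluates f xs z"
    by (rule evaluates_PrimRec_0E)
  then show ?case by (rule PrimRec_0.IH)
next
  case (PrimRec_Suc f g n xs y y')
  from PrimRec_Suc.prems obtain w
    where w: "evaluates (PrimRec f g) (n # xs) w"
    and z: "evaluates g (n # w # xs) z"
    by (rule evaluates_PrimRec_SucE)
  from w have "y = w"
    using PrimRec_Suc.IH(1) by simp
  with z show ?case
    using PrimRec_Suc.IH(2) by simp
next
  case (Mu f n xs)
  have z: "evaluates f (z # xs) 0"
    using Mu.prems by (rule evaluates_MuE)
  have below: "\<exists>y>0. evaluates f (m # xs) y" if "m < z" for m
    using Mu.prems by (rule evaluates_MuE) (use that in blast)
  show ?case
  proof (rule linorder_cases[of n z])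
    assume "n < z"
    then obtain w where "w > 0" "evaluates f (n # xs) w"
      using below by blast
    then show ?thesis using Mu.IH(1)[of w] by simp
  next
    assume "z < n"
    then obtain w where "w > 0" "\<forall>v. evaluates f (z # xs) v \<longrightarrow> w = v"
      using Mu.IH(2)[of z] by blast
    then show ?thesis using z by blast
  qed
qed

text \<open>\<open>quotient_of\<close> yields lowest terms with a positive denominator.\<close>

definition rat_code :: "rat \<Rightarrow> nat" where
  "rat_code x = (case quotient_of x of (p, q) \<Rightarrow> prod_encode (int_encode p, nat q))"

lemma inj_rat_code: "inj rat_code"
proof (rule injI)
  fix x y assume "rat_code x = rat_code y"
  then have "quotient_of x = quotient_of y"
    using quotient_of_denom_pos'[of x] quotient_of_denom_pos'[of y]
    by (auto simp: rat_code_def int_encode_eq split: prod.splits)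
  then show "x = y"
    by (simp add: quotient_of_inject)
qed

text \<open>
  The partial recursive function \<open>f\<close>, with the parameters \<open>xs\<close> fixed, computes the sequence
  \<open>s\<close>. Uniform computability of a family of sequences is expressed by using the same \<open>f\<close> for
  all values of the parameters.
\<close>

definition computes_rat_seq :: "recf \<Rightarrow> nat list \<Rightarrow> (nat \<Rightarrow> rat) \<Rightarrow> bool" where
  "computes_rat_seq f xs s \<longleftrightarrow> (\<forall>i. evaluates f (xs @ [i]) (rat_code (s i)))"

definition computable_rat_seq :: "(nat \<Rightarrow> rat) \<Rightarrow> bool" where
  "computable_rat_seq s \<longleftrightarrow> (\<exists>f. computes_rat_seq f [] s)"

definition uniformly_computable_rat_seqs :: "(nat \<Rightarrow> nat \<Rightarrow> rat) \<Rightarrow> bool" where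
  "uniformly_computable_rat_seqs s \<longleftrightarrow> (\<exists>f. \<forall>n. computes_rat_seq f [n] (s n))"

text \<open>
  Requiring the enumerations of intervals to be total is no restriction: an interval whose left
  endpoint is not below its right endpoint is empty and can be used as padding.
\<close>

definition uniformly_effectively_open :: "(nat \<Rightarrow> real set) \<Rightarrow> bool" where
  "uniformly_effectively_open U \<longleftrightarrow>
    (\<exists>l r. uniformly_computable_rat_seqs l \<and> uniformly_computable_rat_seqs r \<and>
      (\<forall>n. U n = (\<Union>k. {real_of_rat (l n k) <..< real_of_rat (r n k)})))"

definition martin_loef_test :: "(nat \<Rightarrow> real set) \<Rightarrow> bool" where
  "martin_loef_test U \<longleftrightarrow>
    uniformly_effectively_open U \<and> (\<forall>n. emeasure lborel (U n) \<le> ennreal ((1 / 2) ^ n))"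

definition martin_loef_random :: "real \<Rightarrow> bool" where
  "martin_loef_random x \<longleftrightarrow> (\<forall>U. martin_loef_test U \<longrightarrow> x \<notin> (\<Inter>n. U n))"

end

theory Submission
  imports Defs
begin

text \<open>
  If \<open>\<alpha>\<close> lies in every member of a test, take \<open>n\<close> to be the denominator of \<open>\<epsilon>\<close>, so that the
  \<open>n\<close>-th test set has measure at most \<open>2\<^sup>-\<^sup>n < 1 / n \<le> \<epsilon>\<close>. At stage \<open>i\<close>, if \<open>a\<^sub>i\<close> is not below the
  right end of an earlier interval, jump from \<open>a\<^sub>i\<close> to the largest right endpoint of the intervals
  enumerated so far that contain \<open>a\<^sub>i\<close>. The intervals jumped over are disjoint and inside the test set, so
  the jumps sum to at most its measure. Once \<open>a\<^sub>i\<close> has entered an interval around \<open>\<alpha>\<close>, the next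
  jump passes \<open>\<alpha>\<close>; if there is no further jump, an earlier one has passed \<open>\<alpha>\<close>.

  Conversely, the intervals from \<open>a\<^sub>i\<close> to \<open>a\<^sub>i + h\<^sub>i\<close>, widened by \<open>2\<^sup>-\<^sup>(\<^sup>n\<^sup>+\<^sup>i\<^sup>+\<^sup>3\<^sup>)\<close> on either side, form a test
  when \<open>h\<close> belongs to \<open>\<epsilon> = 2\<^sup>-\<^sup>(\<^sup>n\<^sup>+\<^sup>1\<^sup>)\<close>.
\<close>

subsection \<open>Recursive functions of coded arguments\<close>

text \<open>The environment \<open>e\<close> lists the codes of the typed variables packed in \<open>x\<close>; only tuples of
  valid codes matter, so functions of rationals need no behaviour on other naturals.\<close>

definition rec_fun :: "('a \<Rightarrow> nat list) \<Rightarrow> ('a \<Rightarrow> nat) \<Rightarrow> bool" where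
  "rec_fun e g \<longleftrightarrow> (\<exists>f. \<forall>x. evaluates f (e x) (g x))"

abbreviation rec_pred :: "('a \<Rightarrow> nat list) \<Rightarrow> ('a \<Rightarrow> bool) \<Rightarrow> bool" where
  "rec_pred e P \<equiv> rec_fun e (\<lambda>x. of_bool (P x))"

text \<open>Composition in typed form. The functions \<open>hs\<close> need only produce the codes
  that make up the environment of \<open>t x\<close>; the components of \<open>t x\<close> may be
  rationals rather than naturals.\<close>

lemma rec_fun_subst:
  assumes g: "rec_fun e' g" and hs: "\<forall>h\<in>set hs. rec_fun e h"
    and t: "\<And>x. e' (t x) = map (\<lambda>h. h x) hs"
  shows "rec_fun e (\<lambda>x. g (t x))"
proof -
  obtain f where f: "\<And>x. evaluates f (e' x) (g x)"
    using g by (auto simp: rec_fun_def)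
  obtain F where F: "\<And>h x. h \<in> set hs \<Longrightarrow> evaluates (F h) (e x) (h x)"
    using hs unfolding rec_fun_def by metis
  have "evaluates (Comp f (map F hs)) (e x) (g (t x))" for x
  proof (rule evaluates.Comp)
    show "list_all2 (\<lambda>g y. evaluates g (e x) y) (map F hs) (e' (t x))"
      using F by (simp add: t list_all2_conv_all_nth)
  qed (rule f)
  then show ?thesis by (auto simp: rec_fun_def)
qed

text \<open>Projections, stated separately for each position so that they unify directly as
  introduction rules.\<close>

lemma rec_fun_var0: "rec_fun (\<lambda>x. g x # e x) g"
  and rec_fun_var1: "rec_fun (\<lambda>x. h0 x # g x # e x) g"
  and rec_fun_var2: "rec_fun (\<lambda>x. h0 x # h1 x # g x # e x) g"
  and rec_fun_var3: "rec_fun (\<lambda>x. h0 x # h1 x # h2 x # g x # e x) g"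
proof -
  have "rec_fun e g" if "\<And>x. i < length (e x)" "\<And>x. e x ! i = g x" for e :: "'a \<Rightarrow> nat list" and g i
    unfolding rec_fun_def using that evaluates.Proj by metis
  from this[of 0] this[of 1] this[of 2] this[of 3]
  show "rec_fun (\<lambda>x. g x # e x) g" "rec_fun (\<lambda>x. h0 x # g x # e x) g"
    "rec_fun (\<lambda>x. h0 x # h1 x # g x # e x) g" "rec_fun (\<lambda>x. h0 x # h1 x # h2 x # g x # e x) g"
    by (auto simp: numeral_eq_Suc)
qed

lemmas rec_fun_var = rec_fun_var0 rec_fun_var1 rec_fun_var2 rec_fun_var3

lemma rec_fun_unary:
  assumes "rec_fun (\<lambda>n. [n]) F" and "rec_fun e g"
  shows "rec_fun e (\<lambda>x. F (g x))"
  by (rule rec_fun_subst[where hs = "[g]", OF assms(1)]) (use assms in auto)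

lemma rec_fun_binary:
  assumes "rec_fun (\<lambda>(m, n). [m, n]) (\<lambda>(m, n). F m n)" and "rec_fun e g" and "rec_fun e h"
  shows "rec_fun e (\<lambda>x. F (g x) (h x))"
  using rec_fun_subst[where hs = "[g, h]" and t = "\<lambda>x. (g x, h x)", OF assms(1)] assms(2,3) by auto

lemma rec_fun_Suc:
  assumes "rec_fun e g"
  shows "rec_fun e (\<lambda>x. Suc (g x))"
proof (rule rec_fun_unary[OF _ assms])
  show "rec_fun (\<lambda>n. [n]) Suc" unfolding rec_fun_def using evaluates.Succ by blast
qed

lemma rec_fun_const: "rec_fun e (\<lambda>_. c)"
proof (induction c)
  case 0
  show ?case unfolding rec_fun_def using evaluates.Zero by blast
qed (rule rec_fun_Suc)

text \<open>The encoding \<open>c\<close> allows recursion with non-numerical values: it is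
  \<open>id\<close> for naturals and \<open>rat_code\<close> for rationals. Every intermediate value
  is some \<open>c y\<close>, so the step function need only be correct on such codes.\<close>

lemma rec_fun_rec:
  assumes b: "rec_fun e (\<lambda>x. c (b x))"
    and s: "rec_fun (\<lambda>(n, y, x). n # c y # e x) (\<lambda>(n, y, x). c (s n y x))"
  shows "rec_fun (\<lambda>(n, x). n # e x) (\<lambda>(n, x). c (rec_nat (b x) (\<lambda>n y. s n y x) n))"
proof -
  obtain fb where fb: "\<And>x. evaluates fb (e x) (c (b x))"
    using b by (auto simp: rec_fun_def)
  obtain fs where fs: "\<And>n y x. evaluates fs (n # c y # e x) (c (s n y x))"
    using s by (auto simp: rec_fun_def)
  have "evaluates (PrimRec fb fs) (n # e x) (c (rec_nat (b x) (\<lambda>n y. s n y x) n))" for n x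
    by (induction n) (auto intro: evaluates.PrimRec_0 evaluates.PrimRec_Suc fb fs)
  then show ?thesis by (auto simp: rec_fun_def)
qed

text \<open>\<open>Mu\<close> looks for a zero, which is why the recursive predicate is the negation
  of \<open>P\<close>. It is 1 at every argument before the first success, so the search is defined
  there.\<close>

lemma rec_fun_Least:
  assumes P: "rec_pred (\<lambda>(n, x). n # e x) (\<lambda>(n, x). \<not> P n x)" and ex: "\<And>x. \<exists>n. P n x"
  shows "rec_fun e (\<lambda>x. LEAST n. P n x)"
proof -
  obtain f where f: "\<And>n x. evaluates f (n # e x) (of_bool (\<not> P n x))"
    using P by (auto simp: rec_fun_def)
  have "evaluates (Mu f) (e x) (LEAST n. P n x)" for x
  proof (rule evaluates.Mu)
    show "evaluates f ((LEAST n. P n x) # e x) 0"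
      using f[of "LEAST n. P n x" x] LeastI_ex[OF ex, of x] by simp
    show "\<exists>y>0. evaluates f (m # e x) y" if "m < (LEAST n. P n x)" for m
      using f[of m x] not_less_Least[OF that] by auto
  qed
  then show ?thesis by (auto simp: rec_fun_def)
qed

subsection \<open>Arithmetic\<close>

lemma rec_fun_add:
  assumes "rec_fun e g" and "rec_fun e h"
  shows "rec_fun e (\<lambda>x. g x + h x)"
proof (rule rec_fun_binary[OF _ assms])
  have "rec_nat x (\<lambda>n y. Suc y) n = n + x" for x n by (induction n) auto
  moreover have "rec_fun (\<lambda>(n, x). n # [x]) (\<lambda>(n, x). id (rec_nat x (\<lambda>n y. Suc y) n))"
    by (rule rec_fun_rec; unfold case_prod_unfold id_def) (intro rec_fun_Suc rec_fun_var)+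
  ultimately show "rec_fun (\<lambda>(m, n). [m, n]) (\<lambda>(m, n). m + n)" by simp
qed

lemma rec_fun_mult:
  assumes "rec_fun e g" and "rec_fun e h"
  shows "rec_fun e (\<lambda>x. g x * h x)"
proof (rule rec_fun_binary[OF _ assms])
  have "rec_nat 0 (\<lambda>n y. y + x) n = n * x" for x n :: nat by (induction n) auto
  moreover have "rec_fun (\<lambda>(n, x). n # [x]) (\<lambda>(n, x). id (rec_nat 0 (\<lambda>n y. y + x) n))"
    by (rule rec_fun_rec; unfold case_prod_unfold id_def) (intro rec_fun_const rec_fun_add rec_fun_var)+
  ultimately show "rec_fun (\<lambda>(m, n). [m, n]) (\<lambda>(m, n). m * n)" by simp
qed

lemma rec_fun_power2:
  assumes "rec_fun e g"
  shows "rec_fun e (\<lambda>x. 2 ^ g x)"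
proof -
  have "rec_nat 1 (\<lambda>n y. y + y) n = (2::nat) ^ n" for n by (induction n) auto
  \<comment> \<open>The recursion has no parameter; a dummy of type \<open>unit\<close> with empty
    environment takes its place.\<close>
  moreover have "rec_fun (\<lambda>(n, x). n # []) (\<lambda>(n, x::unit). id (rec_nat 1 (\<lambda>n y. y + y) n))"
    by (rule rec_fun_rec; unfold case_prod_unfold id_def) (intro rec_fun_const rec_fun_add rec_fun_var)+
  ultimately have "rec_fun (\<lambda>(n, x). [n]) (\<lambda>(n, x::unit). 2 ^ n)" by simp
  from rec_fun_subst[where hs = "[g]" and t = "\<lambda>x. (g x, ())" and e = e, OF this] assms
  show ?thesis by simp
qed

text \<open>The predecessor is a recursion that returns its counter, and subtraction iterates the
  predecessor. The counter of the iteration is the subtrahend, hence the swapped arguments at the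
  end.\<close>

lemma rec_fun_diff:
  assumes "rec_fun e g" and "rec_fun e h"
  shows "rec_fun e (\<lambda>x. g x - h x)"
proof -
  have "rec_nat 0 (\<lambda>n y. n) n = n - 1" for n by (cases n) auto
  moreover have "rec_fun (\<lambda>(n, x). n # []) (\<lambda>(n, x::unit). id (rec_nat 0 (\<lambda>n y. n) n))"
    by (rule rec_fun_rec; unfold case_prod_unfold id_def) (intro rec_fun_const rec_fun_var)+
  ultimately have 1: "rec_fun (\<lambda>(n, x). [n]) (\<lambda>(n, x::unit). n - 1)" by simp
  have pred: "rec_fun e (\<lambda>x. g x - 1)" if "rec_fun e g" for e :: "'b \<Rightarrow> nat list" and g
    using rec_fun_subst[where hs = "[g]" and t = "\<lambda>x. (g x, ())" and e = e, OF 1] that by simp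
  have "rec_nat x (\<lambda>n y. y - 1) n = x - n" for x n :: nat by (induction n) auto
  moreover have "rec_fun (\<lambda>(n, x). n # [x]) (\<lambda>(n, x). id (rec_nat x (\<lambda>n y. y - 1) n))"
    by (rule rec_fun_rec; unfold case_prod_unfold id_def) (intro pred rec_fun_var)+
  ultimately have "rec_fun (\<lambda>(n, x). [n, x]) (\<lambda>(n, x). x - n)" by simp
  from rec_fun_binary[OF this assms(2,1)] show ?thesis .
qed

lemmas rec_fun_arith = rec_fun_var rec_fun_const rec_fun_Suc rec_fun_add rec_fun_mult
  rec_fun_power2 rec_fun_diff

lemma rec_pred_less:
  assumes "rec_fun e g" and "rec_fun e h"
  shows "rec_pred e (\<lambda>x. g x < h x)"
proof -
  \<comment> \<open>By truncation, the inner difference is 0 exactly if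
    \<open>g x < h x\<close>.\<close>
  have "rec_fun e (\<lambda>x. 1 - (Suc (g x) - h x))"
    by (intro rec_fun_arith assms)
  also have "(\<lambda>x. 1 - (Suc (g x) - h x)) = (\<lambda>x. of_bool (g x < h x))" by auto
  finally show ?thesis .
qed

lemma rec_pred_conj:
  assumes "rec_pred e P" and "rec_pred e Q"
  shows "rec_pred e (\<lambda>x. P x \<and> Q x)"
  using rec_fun_mult[OF assms] by (simp flip: of_bool_conj)

lemma rec_pred_not:
  assumes "rec_pred e P"
  shows "rec_pred e (\<lambda>x. \<not> P x)"
proof -
  have "rec_fun e (\<lambda>x. 1 - of_bool (P x))"
    by (intro rec_fun_arith assms)
  also have "(\<lambda>x. 1 - of_bool (P x)) = (\<lambda>x. of_bool (\<not> P x) :: nat)" by auto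
  finally show ?thesis .
qed

lemma rec_pred_eq:
  assumes "rec_fun e g" and "rec_fun e h"
  shows "rec_pred e (\<lambda>x. g x = h x)"
proof -
  have "rec_pred e (\<lambda>x. \<not> g x < h x \<and> \<not> h x < g x)"
    by (intro rec_pred_conj rec_pred_not rec_pred_less assms)
  also have "(\<lambda>x. \<not> g x < h x \<and> \<not> h x < g x) = (\<lambda>x. g x = h x)" by auto
  finally show ?thesis .
qed

lemmas rec_pred_intros = rec_pred_less rec_pred_eq rec_pred_conj rec_pred_not

lemma rec_fun_If:
  assumes "rec_pred e P" and "rec_fun e g" and "rec_fun e h"
  shows "rec_fun e (\<lambda>x. if P x then g x else h x)"
proof -
  have "rec_fun e (\<lambda>x. of_bool (P x) * g x + of_bool (\<not> P x) * h x)"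
    by (intro rec_fun_arith rec_pred_not assms)
  also have "(\<lambda>x. of_bool (P x) * g x + of_bool (\<not> P x) * h x) = (\<lambda>x. if P x then g x else h x)"
    by auto
  finally show ?thesis .
qed

lemma rec_fun_div2:
  assumes "rec_fun e g"
  shows "rec_fun e (\<lambda>x. g x div 2)"
proof (rule rec_fun_unary[OF _ assms])
  have "rec_fun (\<lambda>n. [n]) (\<lambda>n. LEAST k. n < 2 * k + 2)"
  proof (rule rec_fun_Least)
    show "\<exists>k. n < 2 * k + 2" for n :: nat by presburger
  qed (unfold case_prod_unfold, intro rec_pred_intros rec_fun_arith)
  moreover have "(LEAST k. n < 2 * k + 2) = n div 2" for n :: nat
    by (rule Least_equality) auto
  ultimately show "rec_fun (\<lambda>n. [n]) (\<lambda>n. n div 2)" by simp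
qed

lemma rec_pred_even:
  assumes "rec_fun e g"
  shows "rec_pred e (\<lambda>x. even (g x))"
proof -
  have "rec_pred e (\<lambda>x. 2 * (g x div 2) = g x)"
    by (intro rec_pred_intros rec_fun_arith rec_fun_div2 assms)
  also have "(\<lambda>x. 2 * (g x div 2) = g x) = (\<lambda>x. even (g x))" by (auto simp: fun_eq_iff) presburger+
  finally show ?thesis .
qed

section \<open>Decoding pairs and codes of rationals\<close>

lemma triangle_less_Suc: "n < triangle (Suc n)"
  by (induction n) auto

lemma rec_fun_triangle:
  assumes "rec_fun e g"
  shows "rec_fun e (\<lambda>x. triangle (g x))"
proof -
  have "rec_fun e (\<lambda>x. g x * Suc (g x) div 2)"
    by (intro rec_fun_arith rec_fun_div2 assms)
  then show ?thesis by (simp only: triangle_def)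
qed

text \<open>The code of \<open>(p, q)\<close> is \<open>triangle (p + q) + p\<close> with
  \<open>p \<le> p + q\<close>, so it lies before the next triangular number. The search therefore
  finds the diagonal \<open>s = p + q\<close>, from which \<open>p\<close> and \<open>q\<close> are
  read off.\<close>

lemma prod_decode_eq_triangle:
  assumes "s = (LEAST s. n < triangle (Suc s))"
  shows "prod_decode n = (n - triangle s, s - (n - triangle s))"
proof -
  obtain p q where n: "n = prod_encode (p, q)" by (metis prod_decode_inverse surj_pair)
  have "(LEAST s. n < triangle (Suc s)) = p + q"
  proof (rule Least_equality)
    show "p + q \<le> s" if "n < triangle (Suc s)" for s
    proof (rule ccontr)
      assume "\<not> p + q \<le> s"
      then have "triangle (Suc s) \<le> triangle (p + q)"
        unfolding triangle_def by (intro div_le_mono mult_le_mono) auto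
      with that n show False by (simp add: prod_encode_def)
    qed
  qed (simp add: n prod_encode_def)
  then show ?thesis unfolding assms by (simp add: n) (simp add: prod_encode_def)
qed

lemma rec_fun_prod_decode:
  assumes "rec_fun e g"
  shows "rec_fun e (\<lambda>x. fst (prod_decode (g x)))" and "rec_fun e (\<lambda>x. snd (prod_decode (g x)))"
proof -
  have s: "rec_fun (\<lambda>n. [n]) (\<lambda>n. LEAST s. n < triangle (Suc s))"
  proof (rule rec_fun_Least)
    show "\<exists>s. n < triangle (Suc s)" for n using triangle_less_Suc by blast
  qed (unfold case_prod_unfold, intro rec_pred_intros rec_fun_arith rec_fun_triangle)
  have "rec_fun (\<lambda>n. [n]) (\<lambda>n. fst (prod_decode n))" "rec_fun (\<lambda>n. [n]) (\<lambda>n. snd (prod_decode n))"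
    unfolding prod_decode_eq_triangle[OF refl] fst_conv snd_conv
    by (intro rec_fun_arith rec_fun_triangle s)+
  from this[THEN rec_fun_unary, OF assms]
  show "rec_fun e (\<lambda>x. fst (prod_decode (g x)))" "rec_fun e (\<lambda>x. snd (prod_decode (g x)))" .
qed

text \<open>The numerator is split into a positive and a negative part, so that identities between
  fractions can be stated with sums and products of naturals only.\<close>

definition code_pos :: "nat \<Rightarrow> nat" where
  "code_pos c = nat (int_decode (fst (prod_decode c)))"

definition code_neg :: "nat \<Rightarrow> nat" where
  "code_neg c = nat (- int_decode (fst (prod_decode c)))"

definition code_den :: "nat \<Rightarrow> nat" where
  "code_den c = snd (prod_decode c)"

lemma nat_int_decode:
  "nat (int_decode c) = (if even c then c div 2 else 0)"
  "nat (- int_decode c) = (if even c then 0 else Suc (c div 2))"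
  by (auto simp: int_decode_def sum_decode_def)

lemma rec_fun_code:
  assumes "rec_fun e g"
  shows "rec_fun e (\<lambda>x. code_pos (g x))" and "rec_fun e (\<lambda>x. code_neg (g x))"
    and "rec_fun e (\<lambda>x. code_den (g x))"
  unfolding code_pos_def code_neg_def code_den_def nat_int_decode
  by (intro rec_fun_If rec_pred_even rec_fun_arith rec_fun_div2 rec_fun_prod_decode assms)+


subsection \<open>Rational arithmetic on codes\<close>

lemma prod_encode_mono:
  assumes "a \<le> a'" and "b \<le> b'"
  shows "prod_encode (a, b) \<le> prod_encode (a', b')"
proof -
  have "triangle (a + b) \<le> triangle (a' + b')"
    unfolding triangle_def using assms by (intro div_le_mono mult_le_mono) auto
  then show ?thesis using assms by (simp add: prod_encode_def)
qed

text \<open>Fractions that are not in lowest terms are decoded as well, so a rational has many codes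
  besides its \<open>rat_code\<close>. Denominator 0 gives the value 0, hence the conditions
  \<open>code_den c > 0\<close> below.\<close>

definition code_val :: "nat \<Rightarrow> rat" where
  "code_val c = (of_nat (code_pos c) - of_nat (code_neg c)) / of_nat (code_den c)"

lemma code_val_eq: "code_val c = of_int (int_decode (fst (prod_decode c))) / of_nat (code_den c)"
proof -
  have "of_nat (nat p) - of_nat (nat (- p)) = (of_int p :: rat)" for p
    by (cases "p \<ge> 0") (auto simp: of_nat_nat)
  then show ?thesis by (simp add: code_val_def code_pos_def code_neg_def)
qed

lemma code_den_rat_code: "code_den (rat_code x) > 0"
  and code_val_rat_code: "code_val (rat_code x) = x"
proof -
  obtain p q where pq: "quotient_of x = (p, q)" by fastforce
  then have "q > 0" by (rule quotient_of_denom_pos)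
  with pq show "code_den (rat_code x) > 0" "code_val (rat_code x) = x"
    by (auto simp: code_val_eq rat_code_def code_den_def quotient_of_div[OF pq])
qed

text \<open>By coprimality, the fraction coded by \<open>c\<close> is the reduced one expanded by
  some \<open>k > 0\<close>. Expanding keeps the sign and does not decrease the absolute value of
  the numerator, so neither component of the code decreases, and pairing is monotone.\<close>

lemma rat_code_le:
  assumes "code_den c > 0"
  shows "rat_code (code_val c) \<le> c"
proof -
  define p q where "p = int_decode (fst (prod_decode c))" and "q = code_den c"
  obtain p' q' where pq': "quotient_of (code_val c) = (p', q')" by fastforce
  have q': "q' > 0" and "coprime p' q'"
    using quotient_of_denom_pos[OF pq'] quotient_of_coprime[OF pq'] .
  have "of_int p / (of_nat q :: rat) = of_int p' / of_int q'"
    using quotient_of_div[OF pq'] by (simp add: code_val_eq p_def q_def)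
  then have "of_int (p * q') = (of_int (p' * int q) :: rat)"
    using q' assms by (simp add: field_simps q_def)
  then have eq: "p * q' = p' * int q" by (simp only: of_int_eq_iff)
  then have "q' dvd p' * int q" by (metis dvd_triv_right)
  with \<open>coprime p' q'\<close> have "q' dvd int q"
    by (simp add: coprime_commute coprime_dvd_mult_right_iff)
  then obtain k where k: "int q = q' * k" ..
  then have "k > 0" using q' assms by (metis q_def of_nat_0_less_iff zero_less_mult_pos)
  have p: "p = p' * k" using eq k q' by simp
  have "int_encode p' \<le> int_encode p"
  proof (cases "p' \<ge> 0")
    case True
    then have "p' \<le> p" using \<open>k > 0\<close> by (simp add: p mult_le_cancel_left1)
    with True show ?thesis by (simp add: int_encode_def sum_encode_def)
  next
    case False
    then have "p \<le> p'" using \<open>k > 0\<close> by (simp add: p mult_le_cancel_left2)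
    with False show ?thesis by (simp add: int_encode_def sum_encode_def)
  qed
  moreover have "nat q' \<le> q"
    using k \<open>k > 0\<close> q' by (simp add: nat_le_iff mult_le_cancel_left1)
  ultimately have "rat_code (code_val c) \<le> prod_encode (int_encode p, q)"
    by (simp add: rat_code_def pq' prod_encode_mono)
  then show ?thesis by (simp add: p_def q_def code_den_def)
qed

text \<open>Least codes are in lowest terms, so an unbounded search replaces the computation of a gcd.\<close>

lemma rec_fun_rat_of_nats:
  assumes "rec_fun e u" and "rec_fun e v" and "rec_fun e q" and q: "\<And>x. q x > 0"
  shows "rec_fun e (\<lambda>x. rat_code ((of_nat (u x) - of_nat (v x)) / of_nat (q x)))"
proof -
  \<comment> \<open>The equation \<open>code_val c = (u - v) / Suc d\<close>, multiplied out with
    all negative terms moved across. Writing the denominator as \<open>Suc d\<close> keeps it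
    positive in every environment, so that the search always succeeds; \<open>q x - 1\<close> is
    substituted for \<open>d\<close> at the end.\<close>
  let ?P = "\<lambda>c (u, v, d). code_den c > 0 \<and>
    code_pos c * Suc d + v * code_den c = code_neg c * Suc d + u * code_den c"
  have P: "?P c (u, v, d) \<longleftrightarrow> code_den c > 0 \<and> code_val c = (of_nat u - of_nat v) / of_nat (Suc d)" for c u v d
  proof (cases "code_den c > 0")
    case True
    have cross: "(p - n) / m = (y - z) / w \<longleftrightarrow> p * w + z * m = n * w + y * m"
      if "m \<noteq> 0" "w \<noteq> 0" for p n m y z w :: rat
      using that by (simp add: frac_eq_eq algebra_simps)
    have "code_val c = (of_nat u - of_nat v) / of_nat (Suc d) \<longleftrightarrow>
      (of_nat (code_pos c * Suc d + v * code_den c) :: rat) = of_nat (code_neg c * Suc d + u * code_den c)"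
      unfolding code_val_def of_nat_add of_nat_mult using True by (intro cross) auto
    then show ?thesis using True by (simp only: of_nat_eq_iff) simp
  qed simp
  have L: "(LEAST c. ?P c (u, v, d)) = rat_code ((of_nat u - of_nat v) / of_nat (Suc d))" for u v d
    unfolding P
  proof (rule Least_equality)
    show "rat_code ((of_nat u - of_nat v) / of_nat (Suc d)) \<le> c"
      if "code_den c > 0 \<and> code_val c = (of_nat u - of_nat v) / of_nat (Suc d)" for c
      using rat_code_le[OF that[THEN conjunct1]] by (simp only: that[THEN conjunct2])
  qed (simp add: code_den_rat_code code_val_rat_code)
  have "rec_fun (\<lambda>(u, v, d). [u, v, d]) (\<lambda>x. LEAST c. ?P c x)"
  proof (rule rec_fun_Least)
    fix x :: "nat \<times> nat \<times> nat"
    obtain u v d where x: "x = (u, v, d)" by (cases x)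
    show "\<exists>c. ?P c x"
      unfolding x P
      by (rule exI[of _ "rat_code ((of_nat u - of_nat v) / of_nat (Suc d))"])
        (simp only: code_den_rat_code code_val_rat_code)
  qed (unfold case_prod_unfold, intro rec_pred_intros rec_fun_arith rec_fun_code)
  moreover have "(\<lambda>x. LEAST c. ?P c x) = (\<lambda>(u, v, d). rat_code ((of_nat u - of_nat v) / of_nat (Suc d)))"
  proof
    fix x :: "nat \<times> nat \<times> nat"
    obtain u v d where x: "x = (u, v, d)" by (cases x)
    show "(LEAST c. ?P c x) = (case x of (u, v, d) \<Rightarrow> rat_code ((of_nat u - of_nat v) / of_nat (Suc d)))"
      unfolding x L by simp
  qed
  ultimately have "rec_fun (\<lambda>(u, v, d). [u, v, d]) (\<lambda>(u, v, d). rat_code ((of_nat u - of_nat v) / of_nat (Suc d)))"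
    by (simp only:)
  from rec_fun_subst[where hs = "[u, v, \<lambda>x. q x - 1]" and t = "\<lambda>x. (u x, v x, q x - 1)" and e = e, OF this]
  have "rec_fun e (\<lambda>x. rat_code ((of_nat (u x) - of_nat (v x)) / of_nat (Suc (q x - 1))))"
    using assms(1-3) rec_fun_diff[OF assms(3) rec_fun_const[of _ 1]] by (simp del: of_nat_Suc)
  then show ?thesis unfolding Suc_diff_1[OF q] .
qed

lemma rec_fun_rat_diff:
  assumes "rec_fun e (\<lambda>x. rat_code (g x))" and "rec_fun e (\<lambda>x. rat_code (h x))"
  shows "rec_fun e (\<lambda>x. rat_code (g x - h x))"
proof -
  let ?u = code_pos and ?v = code_neg and ?q = code_den
  let ?g = "\<lambda>x. rat_code (g x)" and ?h = "\<lambda>x. rat_code (h x)"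
  \<comment> \<open>The difference of two fractions over the product of their denominators, with the
    terms of the numerator grouped by sign. The search in \<open>rec_fun_rat_of_nats\<close> takes
    care of cancelling.\<close>
  have eq: "(of_nat (?u (?g x) * ?q (?h x) + ?v (?h x) * ?q (?g x)) -
      of_nat (?v (?g x) * ?q (?h x) + ?u (?h x) * ?q (?g x))) / of_nat (?q (?g x) * ?q (?h x)) =
      g x - h x" for x
  proof -
    have cross: "((p * w + z * m) - (n * w + y * m)) / (m * w) = (p - n) / m - (y - z) / w"
      if "m \<noteq> 0" "w \<noteq> 0" for p n m y z w :: rat
      using that by (simp add: diff_frac_eq algebra_simps)
    have "code_val (?g x) - code_val (?h x) = g x - h x"
      by (simp only: code_val_rat_code)
    then show ?thesis
      unfolding code_val_def of_nat_add of_nat_mult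
      using code_den_rat_code[of "g x"] code_den_rat_code[of "h x"] by (subst cross) auto
  qed
  have "rec_fun e (\<lambda>x. rat_code ((of_nat (?u (?g x) * ?q (?h x) + ?v (?h x) * ?q (?g x)) -
      of_nat (?v (?g x) * ?q (?h x) + ?u (?h x) * ?q (?g x))) / of_nat (?q (?g x) * ?q (?h x))))"
    by (intro rec_fun_rat_of_nats rec_fun_arith rec_fun_code assms) (simp add: code_den_rat_code)
  then show ?thesis unfolding eq .
qed

lemma rec_fun_rat_add:
  assumes "rec_fun e (\<lambda>x. rat_code (g x))" and "rec_fun e (\<lambda>x. rat_code (h x))"
  shows "rec_fun e (\<lambda>x. rat_code (g x + h x))"
proof -
  have "rec_fun e (\<lambda>x. rat_code (g x - (0 - h x)))"
    by (intro rec_fun_rat_diff rec_fun_const assms)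
  then show ?thesis by simp
qed

lemma rec_pred_rat_less:
  assumes "rec_fun e (\<lambda>x. rat_code (g x))" and "rec_fun e (\<lambda>x. rat_code (h x))"
  shows "rec_pred e (\<lambda>x. g x < h x)"
proof -
  have "rec_pred e (\<lambda>x. code_neg (rat_code (h x - g x)) < code_pos (rat_code (h x - g x)))"
    by (intro rec_pred_less rec_fun_code rec_fun_rat_diff assms)
  moreover have "code_neg (rat_code z) < code_pos (rat_code z) \<longleftrightarrow> 0 < z" for z
    using code_den_rat_code[of z] arg_cong[OF code_val_rat_code[of z], of "\<lambda>y. 0 < y"]
    by (simp add: code_val_def zero_less_divide_iff)
  ultimately show ?thesis by simp
qed

lemma rec_fun_rat_If:
  assumes "rec_pred e P" and "rec_fun e (\<lambda>x. rat_code (g x))" and "rec_fun e (\<lambda>x. rat_code (h x))"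
  shows "rec_fun e (\<lambda>x. rat_code (if P x then g x else h x))"
  using rec_fun_If[OF assms] by (simp add: if_distrib)

lemma rec_fun_rat_max:
  assumes "rec_fun e (\<lambda>x. rat_code (g x))" and "rec_fun e (\<lambda>x. rat_code (h x))"
  shows "rec_fun e (\<lambda>x. rat_code (max (g x) (h x)))"
proof -
  have "rec_fun e (\<lambda>x. rat_code (if g x < h x then h x else g x))"
    by (intro rec_fun_rat_If rec_pred_rat_less assms)
  also have "(\<lambda>x. rat_code (if g x < h x then h x else g x)) = (\<lambda>x. rat_code (max (g x) (h x)))"
    by (auto simp: max_def)
  finally show ?thesis .
qed

lemma rec_fun_rat_half_power:
  assumes "rec_fun e g"
  shows "rec_fun e (\<lambda>x. rat_code ((1 / 2) ^ g x))"
proof -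
  have "rec_fun e (\<lambda>x. rat_code ((of_nat 1 - of_nat 0) / of_nat (2 ^ g x)))"
    by (intro rec_fun_rat_of_nats rec_fun_arith assms) simp
  then show ?thesis by (simp add: power_one_over)
qed

lemmas rec_fun_rat = rec_fun_rat_add rec_fun_rat_diff rec_fun_rat_If rec_fun_rat_max
  rec_pred_rat_less rec_fun_rat_half_power

subsection \<open>Disjoint jumps inside an open set\<close>

text \<open>Only left ends are compared with \<open>x\<close>: the maximum starts at
  \<open>x\<close>, so an interval that ends at or before \<open>x\<close> does not affect
  it.\<close>

primrec max_endpoint :: "(nat \<Rightarrow> rat) \<Rightarrow> (nat \<Rightarrow> rat) \<Rightarrow> rat \<Rightarrow> nat \<Rightarrow> rat" where
  "max_endpoint l r x 0 = x"
| "max_endpoint l r x (Suc j) =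
    (if l j < x then max (max_endpoint l r x j) (r j) else max_endpoint l r x j)"

lemma max_endpoint_ge: "x \<le> max_endpoint l r x n"
  by (induction n) auto

lemma max_endpoint_ge_right: "k < n \<Longrightarrow> l k < x \<Longrightarrow> r k \<le> max_endpoint l r x n"
  by (induction n) (auto simp: less_Suc_eq le_max_iff_disj)

lemma max_endpoint_cases: "max_endpoint l r x n = x \<or> (\<exists>k. l k < x \<and> max_endpoint l r x n = r k)"
  by (induction n) (auto simp: max_def)

text \<open>\<open>reach i\<close> is the right end of everything covered before stage \<open>i\<close>. A stage starts a new
  interval only if \<open>a i\<close> is not below it, which keeps the intervals disjoint.\<close>

primrec reach :: "(nat \<Rightarrow> rat) \<Rightarrow> (nat \<Rightarrow> rat) \<Rightarrow> (nat \<Rightarrow> rat) \<Rightarrow> nat \<Rightarrow> rat" where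
  "reach a l r 0 = a 0"
| "reach a l r (Suc i) = (if a i < reach a l r i then reach a l r i else max_endpoint l r (a i) i)"

text \<open>The value is also 0 if \<open>a i\<close> is not below \<open>reach\<close> but lies in
  no interval enumerated so far, for then \<open>max_endpoint\<close> returns
  \<open>a i\<close>.\<close>

definition jump :: "(nat \<Rightarrow> rat) \<Rightarrow> (nat \<Rightarrow> rat) \<Rightarrow> (nat \<Rightarrow> rat) \<Rightarrow> nat \<Rightarrow> rat" where
  "jump a l r i = (if a i < reach a l r i then 0 else max_endpoint l r (a i) i - a i)"

lemma jump_nonneg: "jump a l r i \<ge> 0"
  by (simp add: jump_def max_endpoint_ge)

lemma reach_mono: "i \<le> j \<Longrightarrow> reach a l r i \<le> reach a l r j"
proof (rule lift_Suc_mono_le[of "reach a l r"])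
  show "reach a l r n \<le> reach a l r (Suc n)" for n
    using max_endpoint_ge[of "a n" l r n] by auto
qed

text \<open>\<open>reach\<close> starts at \<open>a 0\<close>, and it is only ever replaced by the
  end of the current jump.\<close>

lemma reach_attained: "\<exists>j. reach a l r i \<le> a j + jump a l r j"
proof (induction i)
  case 0
  show ?case using jump_nonneg[of a l r 0] by (intro exI[of _ 0]) simp
next
  case (Suc i)
  then show ?case
  proof (cases "a i < reach a l r i")
    case False
    then show ?thesis by (intro exI[of _ i]) (simp add: jump_def)
  qed simp
qed

lemma jump_eq_reach:
  assumes "jump a l r i \<noteq> 0"
  shows "a i \<ge> reach a l r i" and "a i + jump a l r i = reach a l r (Suc i)"
  using assms by (auto simp: jump_def split: if_splits)

text \<open>For \<open>i < j\<close> with both jumps nonzero, the earlier one ends at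
  \<open>reach a l r (Suc i) \<le> reach a l r j \<le> a j\<close>. A zero jump gives an empty
  interval.\<close>

lemma disjoint_jumps: "disjoint_family (\<lambda>i. {real_of_rat (a i) <..< real_of_rat (a i + jump a l r i)})"
  unfolding disjoint_family_on_def
proof (intro ballI impI)
  let ?A = "\<lambda>i. {real_of_rat (a i) <..< real_of_rat (a i + jump a l r i)}"
  have "?A i \<inter> ?A j = {}" if "i < j" for i j
  proof (cases "jump a l r i = 0 \<or> jump a l r j = 0")
    case False
    then have "a i + jump a l r i \<le> a j"
      using jump_eq_reach[of a l r i] jump_eq_reach[of a l r j] reach_mono[of "Suc i" j a l r] that by auto
    then have "real_of_rat (a i + jump a l r i) \<le> real_of_rat (a j)"
      by (simp add: of_rat_less_eq del: of_rat_add)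
    then show ?thesis by auto
  qed auto
  then show "?A i \<inter> ?A j = {}" if "i \<noteq> j" for i j
    using that by (metis inf_commute linorder_neqE_nat)
qed

text \<open>A nonzero jump ends at some \<open>r k\<close> with \<open>l k < a i\<close>, so the
  \<open>k\<close>-th interval alone contains it.\<close>

lemma jump_subset:
  "{real_of_rat (a i) <..< real_of_rat (a i + jump a l r i)} \<subseteq> (\<Union>k. {real_of_rat (l k) <..< real_of_rat (r k)})"
proof (cases "jump a l r i = 0")
  case False
  then have eq: "a i + jump a l r i = max_endpoint l r (a i) i" and "max_endpoint l r (a i) i \<noteq> a i"
    by (auto simp: jump_def split: if_splits)
  then obtain k where k: "l k < a i" "max_endpoint l r (a i) i = r k"
    using max_endpoint_cases[of l r "a i" i] by blast
  have "real_of_rat (l k) < real_of_rat (a i)" using k by (simp add: of_rat_less)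
  then have "{real_of_rat (a i) <..< real_of_rat (r k)} \<subseteq> {real_of_rat (l k) <..< real_of_rat (r k)}"
    by (intro greaterThanLessThan_subseteq_greaterThanLessThan[THEN iffD2]) simp
  then show ?thesis unfolding eq k(2) by (rule order_trans) (rule UN_upper, rule UNIV_I)
qed auto

text \<open>Each jump is the length of its interval, so by disjointness the jumps sum to the measure
  of a subset of the open set. The sum is taken in \<open>ennreal\<close> first; its finiteness then
  gives summability.\<close>

lemma sum_jumps:
  assumes "emeasure lborel (\<Union>k. {real_of_rat (l k) <..< real_of_rat (r k)}) \<le> ennreal c" and "c \<ge> 0"
  shows "summable (\<lambda>i. real_of_rat (jump a l r i))" and "(\<Sum>i. real_of_rat (jump a l r i)) \<le> c"
proof -
  let ?A = "\<lambda>i. {real_of_rat (a i) <..< real_of_rat (a i + jump a l r i)}"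
  have nonneg: "real_of_rat (jump a l r i) \<ge> 0" for i
    by (simp add: jump_nonneg)
  have "(\<Sum>i. ennreal (real_of_rat (jump a l r i))) = (\<Sum>i. emeasure lborel (?A i))"
    using nonneg by (simp add: of_rat_add)
  also have "\<dots> = emeasure lborel (\<Union>i. ?A i)"
    by (intro suminf_emeasure disjoint_jumps) auto
  also have "\<dots> \<le> emeasure lborel (\<Union>k. {real_of_rat (l k) <..< real_of_rat (r k)})"
    by (intro emeasure_mono UN_least jump_subset) auto
  also note assms(1)
  finally have le: "(\<Sum>i. ennreal (real_of_rat (jump a l r i))) \<le> ennreal c" .
  then have "(\<Sum>i. ennreal (real_of_rat (jump a l r i))) \<noteq> top"
    by (auto simp: top_unique)
  with nonneg show summable: "summable (\<lambda>i. real_of_rat (jump a l r i))"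
    by (rule summable_suminf_not_top)
  with le nonneg show "(\<Sum>i. real_of_rat (jump a l r i)) \<le> c"
    using assms(2) by (simp add: suminf_ennreal2)
qed

lemma jump_passes_limit:
  assumes "incseq a" and lim: "(\<lambda>i. real_of_rat (a i)) \<longlonglongrightarrow> \<alpha>"
    and \<alpha>: "\<alpha> \<in> (\<Union>k. {real_of_rat (l k) <..< real_of_rat (r k)})"
  shows "\<exists>i. \<alpha> \<le> real_of_rat (a i + jump a l r i)"
proof -
  obtain k where k: "real_of_rat (l k) < \<alpha>" "\<alpha> < real_of_rat (r k)"
    using \<alpha> by auto
  obtain N0 where N0: "\<And>i. i \<ge> N0 \<Longrightarrow> real_of_rat (l k) < real_of_rat (a i)"
    using order_tendstoD(1)[OF lim k(1)] by (auto simp: eventually_sequentially)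
  \<comment> \<open>From stage \<open>N\<close> on, \<open>a i\<close> lies to the right of
    \<open>l k\<close>, and interval \<open>k\<close> is among those that
    \<open>max_endpoint\<close> inspects, whose indices are below \<open>i\<close>. A jump from such
    an \<open>a i\<close> gets at least to \<open>r k\<close>.\<close>
  define N where "N = max N0 (Suc k)"
  show ?thesis
  proof (cases "\<exists>i\<ge>N. reach a l r i \<le> a i")
    case True
    then obtain i where i: "i \<ge> N" "reach a l r i \<le> a i" by blast
    then have "l k < a i" using N0[of i] by (simp add: N_def of_rat_less)
    then have "r k \<le> max_endpoint l r (a i) i"
      using i by (intro max_endpoint_ge_right) (auto simp: N_def)
    also have "\<dots> = a i + jump a l r i" using i by (simp add: jump_def)
    finally have "real_of_rat (r k) \<le> real_of_rat (a i + jump a l r i)"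
      by (simp add: of_rat_less_eq del: of_rat_add)
    with k(2) show ?thesis by (intro exI[of _ i]) linarith
  next
    case False
    \<comment> \<open>With every later \<open>a i\<close> below it, \<open>reach\<close> is frozen.
      It then bounds the limit, and it is itself bounded by the end of some jump.\<close>
    have const: "reach a l r i = reach a l r N" if "i \<ge> N" for i
      using that
    proof (induction i rule: dec_induct)
      case (step i)
      then have "a i < reach a l r i" using False step.hyps(1) by (meson not_le)
      with step.IH show ?case by simp
    qed simp
    have "real_of_rat (a i) \<le> real_of_rat (reach a l r N)" if "i \<ge> N" for i
    proof -
      have "a i < reach a l r i" using False that by (meson not_le)
      then show ?thesis by (simp add: const[OF that] of_rat_less_eq)
    qed
    then have "\<alpha> \<le> real_of_rat (reach a l r N)"
      by (intro LIMSEQ_le_const2[OF lim] exI[of _ N]) blast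
    moreover obtain j where "reach a l r N \<le> a j + jump a l r j"
      using reach_attained by blast
    then have "real_of_rat (reach a l r N) \<le> real_of_rat (a j + jump a l r j)"
      by (simp add: of_rat_less_eq del: of_rat_add)
    ultimately show ?thesis by (intro exI[of _ j]) linarith
  qed
qed

section \<open>Computability of the jumps\<close>

lemma recursive_rat_seq:
  assumes "computable_rat_seq a" and "rec_fun e g"
  shows "rec_fun e (\<lambda>x. rat_code (a (g x)))"
proof (rule rec_fun_unary[OF _ assms(2)])
  show "rec_fun (\<lambda>i. [i]) (\<lambda>i. rat_code (a i))"
    using assms(1) by (auto simp: computable_rat_seq_def computes_rat_seq_def rec_fun_def)
qed

lemma recursive_rat_seqs:
  assumes "uniformly_computable_rat_seqs s" and "rec_fun e g" and "rec_fun e h"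
  shows "rec_fun e (\<lambda>x. rat_code (s (g x) (h x)))"
proof (rule rec_fun_binary[OF _ assms(2,3)])
  show "rec_fun (\<lambda>(n, i). [n, i]) (\<lambda>(n, i). rat_code (s n i))"
    using assms(1) by (auto simp: uniformly_computable_rat_seqs_def computes_rat_seq_def rec_fun_def)
qed

lemma rec_fun_max_endpoint:
  assumes l: "uniformly_computable_rat_seqs l" and r: "uniformly_computable_rat_seqs r"
    and "rec_fun e n" and "rec_fun e (\<lambda>x. rat_code (y x))" and "rec_fun e j"
  shows "rec_fun e (\<lambda>x. rat_code (max_endpoint (l (n x)) (r (n x)) (y x) (j x)))"
proof -
  \<comment> \<open>The recursion is rewritten with \<open>rec_nat\<close>, the form that
    \<open>rec_fun_rec\<close> handles; the index \<open>n\<close> and the starting point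
    \<open>y\<close> become parameters.\<close>
  have eq: "rec_nat y (\<lambda>j m. if l n j < y then max m (r n j) else m) j = max_endpoint (l n) (r n) y j"
    for n y j by (induction j) auto
  let ?e = "\<lambda>(n, y). [n, rat_code y]"
    and ?s = "\<lambda>j m (n, y). if l n j < y then max m (r n j) else m"
  have "rec_fun (\<lambda>(j, x). j # ?e x) (\<lambda>(j, x). rat_code (rec_nat (snd x) (\<lambda>j m. ?s j m x) j))"
    by (rule rec_fun_rec[where c = rat_code]; unfold case_prod_unfold)
      (intro rec_fun_rat rec_fun_var recursive_rat_seqs l r)+
  from rec_fun_subst[where hs = "[j, n, \<lambda>x. rat_code (y x)]" and t = "\<lambda>x. (j x, n x, y x)" and e = e, OF this]
  show ?thesis using assms(3-) by (simp add: eq)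
qed

lemma rec_fun_reach:
  assumes a: "computable_rat_seq a"
    and lr: "uniformly_computable_rat_seqs l" "uniformly_computable_rat_seqs r"
    and "rec_fun e n" and "rec_fun e i"
  shows "rec_fun e (\<lambda>x. rat_code (reach a (l (n x)) (r (n x)) (i x)))"
proof -
  have eq: "rec_nat (a 0) (\<lambda>i b. if a i < b then b else max_endpoint (l n) (r n) (a i) i) i =
    reach a (l n) (r n) i" for n i by (induction i) auto
  have "rec_fun (\<lambda>(i, n). i # [n])
    (\<lambda>(i, n). rat_code (rec_nat (a 0) (\<lambda>i b. if a i < b then b else max_endpoint (l n) (r n) (a i) i) i))"
    by (rule rec_fun_rec[where c = rat_code and e = "\<lambda>n. [n]" and b = "\<lambda>_. a 0"
          and s = "\<lambda>i b n. if a i < b then b else max_endpoint (l n) (r n) (a i) i"];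
        (unfold case_prod_unfold)?)
      (intro rec_fun_const rec_fun_rat rec_fun_var rec_fun_max_endpoint recursive_rat_seq a lr)+
  from rec_fun_binary[OF this assms(5,4)]
  show ?thesis by (simp add: eq)
qed

lemma rec_fun_jump:
  assumes a: "computable_rat_seq a"
    and lr: "uniformly_computable_rat_seqs l" "uniformly_computable_rat_seqs r"
    and n: "rec_fun e n" and i: "rec_fun e i"
  shows "rec_fun e (\<lambda>x. rat_code (jump a (l (n x)) (r (n x)) (i x)))"
  unfolding jump_def
  by (intro rec_fun_const rec_fun_rat rec_fun_max_endpoint rec_fun_reach recursive_rat_seq assms)

section \<open>From tests to coverings and back\<close>

lemma covering_of_nonrandom:
  fixes \<alpha> :: real
  assumes a: "computable_rat_seq a" "incseq a" and lim: "(\<lambda>i. real_of_rat (a i)) \<longlonglongrightarrow> \<alpha>"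
    and U: "martin_loef_test U" and \<alpha>: "\<alpha> \<in> (\<Inter>n. U n)"
  shows "\<exists>f. \<forall>\<epsilon>::rat. \<epsilon> > 0 \<longrightarrow>
      (\<exists>h. computes_rat_seq f [rat_code \<epsilon>] h \<and>
        (\<forall>i. h i \<ge> 0) \<and>
        summable (\<lambda>i. real_of_rat (h i)) \<and>
        (\<Sum>i. real_of_rat (h i)) < real_of_rat \<epsilon> \<and>
        (\<exists>i. \<alpha> \<le> real_of_rat (a i + h i)))"
proof -
  obtain l r where lr: "uniformly_computable_rat_seqs l" "uniformly_computable_rat_seqs r"
    and U_eq: "\<And>n. U n = (\<Union>k. {real_of_rat (l n k) <..< real_of_rat (r n k)})"
    using U by (auto simp: martin_loef_test_def uniformly_effectively_open_def)
  \<comment> \<open>The denominator can be read off the code of \<epsilon>, so a single recursive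
    function selects the test set for all \<epsilon>.\<close>
  let ?n = "\<lambda>\<epsilon>. code_den (rat_code \<epsilon>)"
  let ?h = "\<lambda>\<epsilon>. jump a (l (?n \<epsilon>)) (r (?n \<epsilon>))"
  have "rec_fun (\<lambda>(\<epsilon>, i). [rat_code \<epsilon>, i]) (\<lambda>(\<epsilon>, i). rat_code (?h \<epsilon> i))"
    unfolding case_prod_unfold by (intro rec_fun_jump rec_fun_code rec_fun_var a lr)
  then obtain f where f: "\<And>\<epsilon>. computes_rat_seq f [rat_code \<epsilon>] (?h \<epsilon>)"
    by (auto simp: rec_fun_def computes_rat_seq_def)
  have "emeasure lborel (\<Union>k. {real_of_rat (l (?n \<epsilon>) k) <..< real_of_rat (r (?n \<epsilon>) k)})
    \<le> ennreal ((1 / 2) ^ ?n \<epsilon>)" for \<epsilon>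
    using U by (simp add: martin_loef_test_def flip: U_eq)
  note sums = sum_jumps[OF this, of _ a, simplified]
  have sum_less: "(\<Sum>i. real_of_rat (?h \<epsilon> i)) < real_of_rat \<epsilon>" if "\<epsilon> > 0" for \<epsilon>
  proof -
    have "(\<Sum>i. real_of_rat (?h \<epsilon> i)) \<le> 1 / 2 ^ ?n \<epsilon>"
      using sums(2)[of \<epsilon>] by (simp add: power_one_over)
    \<comment> \<open>The measure bounds the sum only weakly; the strict inequality comes from
      \<open>n < 2 ^ n\<close>.\<close>
    also have "1 / 2 ^ ?n \<epsilon> < 1 / real (?n \<epsilon>)"
      using code_den_rat_code[of \<epsilon>] of_nat_less_two_power[of "?n \<epsilon>", where 'a=real]
      by (simp add: frac_less2)
    also have "\<dots> = real_of_rat (1 / of_nat (?n \<epsilon>))" by (simp add: of_rat_divide)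
    also have "\<dots> \<le> real_of_rat \<epsilon>"
    proof -
      let ?p = "int_decode (fst (prod_decode (rat_code \<epsilon>)))"
      have \<epsilon>: "of_int ?p / of_nat (?n \<epsilon>) = \<epsilon>"
        using code_val_rat_code[of \<epsilon>] by (simp add: code_val_eq)
      have "0 < of_int ?p / (of_nat (?n \<epsilon>) :: rat)" unfolding \<epsilon> by (rule that)
      then have "?p > 0" using code_den_rat_code[of \<epsilon>] by (simp add: zero_less_divide_iff)
      \<comment> \<open>A positive integer numerator is at least 1.\<close>
      then have "1 / of_nat (?n \<epsilon>) \<le> of_int ?p / (of_nat (?n \<epsilon>) :: rat)"
        by (intro divide_right_mono) auto
      then show ?thesis unfolding \<epsilon> by (simp only: of_rat_less_eq)
    qed
    finally show ?thesis .
  qed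
  have passes: "\<exists>i. \<alpha> \<le> real_of_rat (a i + ?h \<epsilon> i)" for \<epsilon>
    by (rule jump_passes_limit[OF a(2) lim]) (use \<alpha> U_eq in auto)
  show ?thesis
    by (intro exI[of _ f] allI impI, rule exI, rule conjI, rule f)
      (intro conjI allI jump_nonneg sums(1) sum_less passes)
qed

lemma nonrandom_of_covering:
  fixes \<alpha> :: real
  assumes a: "computable_rat_seq a" "incseq a" and lim: "(\<lambda>i. real_of_rat (a i)) \<longlonglongrightarrow> \<alpha>"
    and f: "\<And>\<epsilon>::rat. \<epsilon> > 0 \<Longrightarrow>
      (\<exists>h. computes_rat_seq f [rat_code \<epsilon>] h \<and>
        (\<forall>i. h i \<ge> 0) \<and>
        summable (\<lambda>i. real_of_rat (h i)) \<and>
        (\<Sum>i. real_of_rat (h i)) < real_of_rat \<epsilon> \<and>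
        (\<exists>i. \<alpha> \<le> real_of_rat (a i + h i)))"
  shows "\<not> martin_loef_random \<alpha>"
proof -
  have "(1 / 2 :: rat) ^ Suc n > 0" for n by simp
  \<comment> \<open>The choice of \<open>h\<close> does not affect computability: each
    \<open>h n\<close> is computed by the same \<open>f\<close> from the code of
    \<open>(1 / 2) ^ Suc n\<close>, which is recursive in \<open>n\<close>.\<close>
  from f[OF this] obtain h where h: "\<forall>n. computes_rat_seq f [rat_code ((1 / 2) ^ Suc n)] (h n) \<and>
        (\<forall>i. h n i \<ge> 0) \<and>
        summable (\<lambda>i. real_of_rat (h n i)) \<and>
        (\<Sum>i. real_of_rat (h n i)) < real_of_rat ((1 / 2) ^ Suc n) \<and>
        (\<exists>i. \<alpha> \<le> real_of_rat (a i + h n i))"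
    using choice[OF allI] by meson
  then have h: "\<And>n. computes_rat_seq f [rat_code ((1 / 2) ^ Suc n)] (h n)"
      "\<And>n i. h n i \<ge> 0" "\<And>n. summable (\<lambda>i. real_of_rat (h n i))"
      "\<And>n. (\<Sum>i. real_of_rat (h n i)) < real_of_rat ((1 / 2) ^ Suc n)"
      "\<And>n. \<exists>i. \<alpha> \<le> real_of_rat (a i + h n i)"
    by blast+
  have h_comp: "rec_fun e (\<lambda>x. rat_code (h (n x) (i x)))" if "rec_fun e n" "rec_fun e i"
    for e :: "nat \<times> nat \<Rightarrow> nat list" and n i
  proof -
    have "rec_fun (\<lambda>(n, i). [rat_code ((1 / 2) ^ Suc n), i]) (\<lambda>(n, i). rat_code (h n i))"
      using h(1) by (auto simp: rec_fun_def computes_rat_seq_def)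
    from rec_fun_subst[where t = "\<lambda>x. (n x, i x)" and e = e and
        hs = "[\<lambda>x. rat_code ((1 / 2) ^ Suc (n x)), i]", OF this]
    show ?thesis
      using that rec_fun_rat_half_power[OF rec_fun_Suc, of e n] by (auto simp del: power_Suc)
  qed
  \<comment> \<open>Widening adds \<open>(1 / 2) ^ (n + i + 2)\<close> to the \<open>i\<close>-th
    length, in total \<open>(1 / 2) ^ Suc n\<close>. The sum of \<open>h n\<close> stays below the
    same bound, so the measure is at most \<open>(1 / 2) ^ n\<close>. Widening on both sides covers
    the cases where \<alpha> is an endpoint of the closed interval.\<close>
  define l r where "l = (\<lambda>n i. a i - (1 / 2) ^ (n + i + 3))" and
    "r = (\<lambda>n i. a i + h n i + (1 / 2) ^ (n + i + 3))"
  have "rec_fun (\<lambda>(n, i). [n, i]) (\<lambda>(n, i). rat_code (l n i))"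
    "rec_fun (\<lambda>(n, i). [n, i]) (\<lambda>(n, i). rat_code (r n i))"
    unfolding l_def r_def case_prod_unfold
    by (intro rec_fun_rat rec_fun_arith recursive_rat_seq h_comp a)+
  then have lr: "uniformly_computable_rat_seqs l" "uniformly_computable_rat_seqs r"
    by (auto simp: uniformly_computable_rat_seqs_def computes_rat_seq_def rec_fun_def)
  define U where "U = (\<lambda>n. \<Union>i. {real_of_rat (l n i) <..< real_of_rat (r n i)})"
  have "emeasure lborel (U n) \<le> ennreal ((1 / 2) ^ n)" for n
  proof -
    have geo: "(\<lambda>i. (1 / 2) ^ (n + i + 2)) sums ((1 / 2) ^ Suc n :: real)"
      using sums_mult[OF geometric_sums[of "1 / 2 :: real"], of "(1 / 2) ^ (n + 2)"]
      by (simp add: power_add mult_ac)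
    have len: "real_of_rat (r n i) - real_of_rat (l n i) = real_of_rat (h n i) + (1 / 2) ^ (n + i + 2)" for i
      unfolding l_def r_def of_rat_add of_rat_diff of_rat_power of_rat_divide
      by (simp add: power_add power2_eq_square power3_eq_cube)
    have nonneg: "real_of_rat (h n i) + (1 / 2) ^ (n + i + 2) \<ge> 0" for i
      using h(2)[of n i] by simp
    have "emeasure lborel (U n) \<le> (\<Sum>i. emeasure lborel {real_of_rat (l n i) <..< real_of_rat (r n i)})"
      unfolding U_def by (rule emeasure_subadditive_countably) auto
    also have "\<dots> = (\<Sum>i. ennreal (real_of_rat (h n i) + (1 / 2) ^ (n + i + 2)))"
      using len nonneg by (intro suminf_cong) (metis diff_ge_0_iff_ge emeasure_lborel_Ioo)
    also have "\<dots> = ennreal (\<Sum>i. real_of_rat (h n i) + (1 / 2) ^ (n + i + 2))"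
      by (intro suminf_ennreal2 nonneg summable_add h(3) sums_summable[OF geo])
    also have "(\<Sum>i. real_of_rat (h n i) + (1 / 2) ^ (n + i + 2)) =
        (\<Sum>i. real_of_rat (h n i)) + (1 / 2) ^ Suc n"
      using suminf_add[OF h(3) sums_summable[OF geo]] sums_unique[OF geo] by simp
    also have "\<dots> \<le> (1 / 2) ^ n"
      using h(4)[of n] by (simp add: of_rat_power of_rat_divide of_rat_mult)
    finally show ?thesis by (simp add: ennreal_leI)
  qed
  with lr have "martin_loef_test U"
    by (auto simp: martin_loef_test_def uniformly_effectively_open_def U_def)
  moreover have "\<alpha> \<in> U n" for n
  proof -
    obtain i where i: "\<alpha> \<le> real_of_rat (a i + h n i)" using h(5) by blast
    have "incseq (\<lambda>i. real_of_rat (a i))"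
      using a(2) by (auto simp: incseq_def of_rat_less_eq)
    \<comment> \<open>An increasing sequence stays at or below its limit, so \<alpha> lies between
      \<open>a i\<close> and \<open>a i + h n i\<close>.\<close>
    then have "real_of_rat (a i) \<le> \<alpha>" using lim by (rule incseq_le)
    moreover have "real_of_rat (l n i) < real_of_rat (a i)"
      "real_of_rat (a i + h n i) < real_of_rat (r n i)"
      by (auto simp: of_rat_less l_def r_def simp del: of_rat_add of_rat_diff)
    ultimately have "\<alpha> \<in> {real_of_rat (l n i) <..< real_of_rat (r n i)}"
      using i by auto
    then show ?thesis by (auto simp: U_def)
  qed
  ultimately show ?thesis by (auto simp: martin_loef_random_def)
qed

theorem theorem5:
  fixes a :: "nat \<Rightarrow> rat" and \<alpha> :: real
  assumes "computable_rat_seq a"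
    and "incseq a"
    and "(\<lambda>i. real_of_rat (a i)) \<longlonglongrightarrow> \<alpha>"
  shows "\<not> martin_loef_random \<alpha> \<longleftrightarrow>
    (\<exists>f. \<forall>\<epsilon>::rat. \<epsilon> > 0 \<longrightarrow>
      (\<exists>h. computes_rat_seq f [rat_code \<epsilon>] h \<and>
        (\<forall>i. h i \<ge> 0) \<and>
        summable (\<lambda>i. real_of_rat (h i)) \<and>
        (\<Sum>i. real_of_rat (h i)) < real_of_rat \<epsilon> \<and>
        (\<exists>i. \<alpha> \<le> real_of_rat (a i + h i))))"
  (is "_ \<longleftrightarrow> ?covering")
proof
  assume "\<not> martin_loef_random \<alpha>"
  then obtain U where "martin_loef_test U" "\<alpha> \<in> (\<Inter>n. U n)"
    by (auto simp: martin_loef_random_def)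
  with assms show ?covering by (rule covering_of_nonrandom)
next
  assume ?covering
  then show "\<not> martin_loef_random \<alpha>" by (elim exE) (rule nonrandom_of_covering[OF assms], blast)
qed

end
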